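(* Let $G=(V,E)$ be a finite, simple, undirected, connected graph, let $L=D-A$ be its Laplacian matrix, and let $\phi_k$ be an eigenvector of $L$ with eigenvalue $\lambda_k$. Fix two vertices $v_s, v_t \in V$ and play the following game: start with payoff $0$ at the vertex $v_s$; whenever you are at a vertex $w \neq v_t$, add $\lambda_k \phi_k(w)/\deg(w)$ to your payoff and then jump to a neighbor of $w$ chosen uniformly at random; when you reach $v_t$, the game ends. (The game ends in finite time almost surely.) Then the expected payoff of the game satisfies $$\mathbb{E}(\text{payoff}) = \phi_k(v_s) - \phi_k(v_t).$$
   Context: $D$ is the diagonal degree matrix with $d_{ii}=\deg(v_i)$ and $A$ is the adjacency matrix of $G$. The random jumps form a simple random walk on $G$ started at $v_s$ and stopped at its first visit to $v_t$; the payoff is accumulated at every visited vertex before $v_t$ (counting repeated visits). *)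

theory Defs
  imports "HOL-Probability.Probability"
begin

text \<open>A simple undirected graph on the finite vertex type \<open>'v\<close> is given by its adjacency relation.\<close>

definition simple_graph :: "('v \<Rightarrow> 'v \<Rightarrow> bool) \<Rightarrow> bool" where
  "simple_graph E \<longleftrightarrow> symp E \<and> irreflp E"

definition connected_graph :: "('v \<Rightarrow> 'v \<Rightarrow> bool) \<Rightarrow> bool" where
  "connected_graph E \<longleftrightarrow> (\<forall>u v. E\<^sup>*\<^sup>* u v)"

definition neighbors :: "('v \<Rightarrow> 'v \<Rightarrow> bool) \<Rightarrow> 'v \<Rightarrow> 'v set" where
  "neighbors E v = {w. E v w}"

definition deg :: "('v \<Rightarrow> 'v \<Rightarrow> bool) \<Rightarrow> 'v \<Rightarrow> nat" where
  "deg E v = card (neighbors E v)"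

definition adjacency_matrix :: "('v::finite \<Rightarrow> 'v \<Rightarrow> bool) \<Rightarrow> real^'v^'v" where
  "adjacency_matrix E = (\<chi> i j. if E i j then 1 else 0)"

definition degree_matrix :: "('v::finite \<Rightarrow> 'v \<Rightarrow> bool) \<Rightarrow> real^'v^'v" where
  "degree_matrix E = (\<chi> i j. if i = j then real (deg E i) else 0)"

definition laplacian :: "('v::finite \<Rightarrow> 'v \<Rightarrow> bool) \<Rightarrow> real^'v^'v" where
  "laplacian E = degree_matrix E - adjacency_matrix E"

definition eigenvector :: "real^'v^'v \<Rightarrow> real^'v \<Rightarrow> real \<Rightarrow> bool" where
  "eigenvector M x c \<longleftrightarrow> x \<noteq> 0 \<and> M *v x = c *s x"

text \<open>
  \<open>X n\<close> is the position after \<open>n\<close> jumps. The jump law is imposed, conditionally on the whole past,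
  only along histories that have not yet met \<open>t\<close>; the positions after the game has ended are
  irrelevant and left unconstrained, so both the full simple random walk and the walk stopped
  at \<open>t\<close> are covered (and so is the graph with a single vertex, where no jump is possible).
\<close>

definition random_game ::
  "('v::finite \<Rightarrow> 'v \<Rightarrow> bool) \<Rightarrow> 'v \<Rightarrow> 'v \<Rightarrow> 'a measure \<Rightarrow> (nat \<Rightarrow> 'a \<Rightarrow> 'v) \<Rightarrow> bool" where
  "random_game E s t M X \<longleftrightarrow>
     prob_space M \<and>
     (\<forall>n. X n \<in> measurable M (count_space UNIV)) \<and>
     (AE \<omega> in M. X 0 \<omega> = s) \<and>
     (\<forall>n x u. (\<forall>i\<le>n. x i \<noteq> t) \<longrightarrow> \<P>(\<omega> in M. \<forall>i\<le>n. X i \<omega> = x i) \<noteq> 0 \<longrightarrow>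
        \<P>(\<omega> in M. X (Suc n) \<omega> = u \<bar> \<forall>i\<le>n. X i \<omega> = x i) = pmf (pmf_of_set (neighbors E (x n))) u)"

text \<open>
  Payoff of a trajectory \<open>x\<close>, summed over all times before the first visit to \<open>t\<close>. If \<open>t\<close> is never
  visited, the index set is infinite and the sum is \<open>0\<close> by convention.
\<close>

definition payoff ::
  "('v::finite \<Rightarrow> 'v \<Rightarrow> bool) \<Rightarrow> real \<Rightarrow> real^'v \<Rightarrow> 'v \<Rightarrow> (nat \<Rightarrow> 'v) \<Rightarrow> real" where
  "payoff E c \<phi> t x = (\<Sum>n\<in>{n. \<forall>m\<le>n. x m \<noteq> t}. c * \<phi> $ x n / real (deg E (x n)))"

text \<open>
  The notion is not vacuous: drawing at each time independent uniform neighbors of all vertices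
  and following them yields such a process.
\<close>

lemma random_game_exists:
  fixes E :: "'v::finite \<Rightarrow> 'v \<Rightarrow> bool"
  shows "\<exists>(M :: (nat \<Rightarrow> 'v \<Rightarrow> 'v) measure) X. random_game E s t M X"
proof -
  define p where "p = Pi_pmf UNIV undefined (\<lambda>w. pmf_of_set (neighbors E w))"
  define M where "M = PiM (UNIV::nat set) (\<lambda>_. measure_pmf p)"
  define X where "X = rec_nat (\<lambda>_. s) (\<lambda>n r \<omega>. (\<omega>::nat \<Rightarrow> 'v \<Rightarrow> 'v) n (r \<omega>))"
  have X0: "X 0 \<omega> = s" and XS: "X (Suc n) \<omega> = \<omega> n (X n \<omega>)" for n \<omega>
    by (simp_all add: X_def)
  interpret product_prob_space "\<lambda>_::nat. measure_pmf p" UNIV ..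
  have spM: "space M = UNIV"
    by (simp add: M_def space_PiM)
  have ev: "{\<omega>. \<forall>i\<le>n. X i \<omega> = x i} =
      (if x 0 = s then prod_emb UNIV (\<lambda>_. measure_pmf p) {..<n} (\<Pi>\<^sub>E i\<in>{..<n}. {f. f (x i) = x (Suc i)}) else {})"
    (is "?L n = ?R n") for n x
  proof (cases "x 0 = s")
    case True
    have "(\<forall>i\<le>n. X i \<omega> = x i) \<longleftrightarrow> (\<forall>i<n. \<omega> i (x i) = x (Suc i))" for \<omega>
    proof (induction n)
      case (Suc n)
      then show ?case by (auto simp: le_Suc_eq less_Suc_eq XS)
    qed (simp add: X0 True)
    then show ?thesis
      using True by (auto simp: prod_emb_def PiE_iff)
  next
    case False
    then show ?thesis using X0 by force
  qed
  have mX: "X n \<in> measurable M (count_space UNIV)" for n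
  proof (induction n)
    case 0
    then show ?case by (simp add: X_def)
  next
    case (Suc n)
    have c: "(\<lambda>\<omega>. \<omega> n) \<in> measurable M (count_space UNIV)"
      using measurable_component_singleton[of n UNIV "\<lambda>_. measure_pmf p"]
      by (simp add: M_def)
    have "(\<lambda>\<omega>. (\<lambda>v \<omega>. \<omega> n v) (X n \<omega>) \<omega>) \<in> measurable M (count_space UNIV)"
    proof (rule measurable_compose_countable'[where I = UNIV])
      show "(\<lambda>\<omega>. \<omega> n v) \<in> measurable M (count_space UNIV)" for v
        using measurable_compose[OF c, of "\<lambda>f. f v" "count_space UNIV"] by simp
    qed (use Suc in \<open>auto simp: countable_finite\<close>)
    moreover have "X (Suc n) = (\<lambda>\<omega>. \<omega> n (X n \<omega>))" by (rule ext) (rule XS)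
    ultimately show ?case by simp
  qed
  have comp: "measure (measure_pmf p) {f. f v = u} = pmf (pmf_of_set (neighbors E v)) u" for v u
  proof -
    have "measure (measure_pmf p) {f. f v = u} = measure (map_pmf (\<lambda>f. f v) p) {u}"
      by (simp add: vimage_def)
    then show ?thesis
      by (simp add: p_def Pi_pmf_component measure_pmf_single)
  qed
  have pr: "measure M {\<omega>. \<forall>i\<le>n. X i \<omega> = x i} =
      (if x 0 = s then \<Prod>i<n. pmf (pmf_of_set (neighbors E (x i))) (x (Suc i)) else 0)" for n x
    unfolding ev M_def by (simp add: measure_PiM_emb comp)
  have "\<P>(\<omega> in M. X (Suc n) \<omega> = u \<bar> \<forall>i\<le>n. X i \<omega> = x i) = pmf (pmf_of_set (neighbors E (x n))) u"
    if nz: "\<P>(\<omega> in M. \<forall>i\<le>n. X i \<omega> = x i) \<noteq> 0" for n x u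
  proof -
    define y where "y = x(Suc n := u)"
    have y: "y i = x i" if "i \<le> n" for i using that by (simp add: y_def)
    have eq: "{\<omega>. X (Suc n) \<omega> = u \<and> (\<forall>i\<le>n. X i \<omega> = x i)} = {\<omega>. \<forall>i\<le>Suc n. X i \<omega> = y i}"
      by (auto simp: y_def le_Suc_eq)
    have "measure M {\<omega>. X (Suc n) \<omega> = u \<and> (\<forall>i\<le>n. X i \<omega> = x i)} =
        measure M {\<omega>. \<forall>i\<le>n. X i \<omega> = x i} * pmf (pmf_of_set (neighbors E (x n))) u"
      unfolding eq pr by (auto simp: y_def intro!: prod.cong)
    then show ?thesis
      using nz by (simp add: cond_prob_def spM)
  qed
  moreover have "prob_space M" by (simp add: M_def prob_space_axioms)
  ultimately have "random_game E s t M X"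
    using mX by (auto simp: random_game_def X0)
  then show ?thesis by blast
qed

end

theory Submission
  imports Defs
begin

text \<open>
  Let \<open>A\<^sub>n\<close> be the event that the walk has not met \<open>t\<close> up to time \<open>n\<close>, and let \<open>P\<close> be the
  transition operator. If \<open>f t = 0\<close> then \<open>\<bbbE>[f(X\<^sub>n\<^sub>+\<^sub>1); A\<^sub>n\<^sub>+\<^sub>1] = \<bbbE>[(P f)(X\<^sub>n); A\<^sub>n]\<close>. The eigenvalue equation
  says that \<open>\<mu> \<phi>(v) / deg v = \<phi>(v) - (P \<phi>)(v)\<close>, so for \<open>\<psi> = \<phi> - \<phi>(t)\<close> the expected gain at time \<open>n\<close> is
  \<open>\<bbbE>[\<psi>(X\<^sub>n); A\<^sub>n] - \<bbbE>[\<psi>(X\<^sub>n\<^sub>+\<^sub>1); A\<^sub>n\<^sub>+\<^sub>1]\<close>, which telescopes to \<open>\<psi>(s)\<close> provided that \<open>\<Sum>\<^sub>n \<bbbP>(A\<^sub>n) < \<infinity>\<close>.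
  The latter follows from the Lyapunov function \<open>g(v) = \<epsilon> ^ d(v, t)\<close>, which for \<open>\<epsilon> = 1 / (2 |V|)\<close>
  satisfies \<open>P g \<ge> 2 g\<close> away from \<open>t\<close>.
\<close>

section \<open>Walks on a finite state space, killed at \<open>t\<close>\<close>

text \<open>The kernel \<open>K\<close> is arbitrary here. The graph enters later, through a drift
  condition and the eigenvalue equation only.\<close>

locale absorbed_walk = prob_space M
  for M :: "'a measure" +
  fixes K :: "'v::finite \<Rightarrow> 'v pmf" and s t :: 'v and X :: "nat \<Rightarrow> 'a \<Rightarrow> 'v"
  assumes X_measurable [measurable]: "\<And>n. X n \<in> measurable M (count_space UNIV)"
    and X_0: "AE \<omega> in M. X 0 \<omega> = s"
    and jump: "\<And>n x u. \<forall>i\<le>n. x i \<noteq> t \<Longrightarrow> \<P>(\<omega> in M. \<forall>i\<le>n. X i \<omega> = x i) \<noteq> 0 \<Longrightarrow>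
      \<P>(\<omega> in M. X (Suc n) \<omega> = u \<bar> \<forall>i\<le>n. X i \<omega> = x i) = pmf (K (x n)) u"
begin

definition alive :: "nat \<Rightarrow> 'a \<Rightarrow> bool" where
  "alive n \<omega> \<longleftrightarrow> (\<forall>i\<le>n. X i \<omega> \<noteq> t)"

text \<open>The expectation of \<open>killed f n\<close> integrates \<open>f\<close> against the
  sub-probability law of the killed walk at time \<open>n\<close>; the value \<open>f t\<close>
  never enters.\<close>

definition killed :: "('v \<Rightarrow> real) \<Rightarrow> nat \<Rightarrow> 'a \<Rightarrow> real" where
  "killed f n \<omega> = (if alive n \<omega> then f (X n \<omega>) else 0)"

text \<open>Extensional functions represent each surviving path exactly once, so expectations become
  finite sums.\<close>

definition histories :: "nat \<Rightarrow> (nat \<Rightarrow> 'v) set" where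
  "histories n = (\<Pi>\<^sub>E i\<in>{..n}. - {t})"

definition follows :: "nat \<Rightarrow> (nat \<Rightarrow> 'v) \<Rightarrow> 'a set" where
  "follows n x = {\<omega>\<in>space M. \<forall>i\<le>n. X i \<omega> = x i}"

lemma alive_measurable [measurable]: "Measurable.pred M (alive n)"
  unfolding alive_def by measurable

lemma follows_sets [measurable]: "follows n x \<in> sets M"
  unfolding follows_def by measurable

lemma killed_measurable [measurable]: "killed f n \<in> borel_measurable M"
  unfolding killed_def by measurable

lemma finite_histories: "finite (histories n)"
  by (simp add: histories_def finite_PiE)

lemma killed_abs_le: "\<bar>killed f n \<omega>\<bar> \<le> (\<Sum>v\<in>UNIV. \<bar>f v\<bar>)"
  by (auto simp: killed_def sum_nonneg intro: member_le_sum)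

lemma killed_integrable: "integrable M (killed f n)"
  by (rule integrable_const_bound[where B = "\<Sum>v\<in>UNIV. \<bar>f v\<bar>"])
    (use killed_abs_le in auto)

text \<open>The sets \<open>follows n x\<close> with \<open>x\<close> in \<open>histories n\<close>
  partition the event \<open>alive n\<close>, so at most one summand is nonzero at each
  \<open>\<omega>\<close>.\<close>

lemma sum_histories:
  assumes "\<omega> \<in> space M"
  shows "(\<Sum>x\<in>histories n. indicator (follows n x) \<omega> * F (x n)) =
    (if alive n \<omega> then F (X n \<omega>) else (0::real))"
proof -
  define y where "y = restrict (\<lambda>i. X i \<omega>) {..n}"
  have "\<omega> \<in> follows n x \<longleftrightarrow> x = y" if "x \<in> histories n" for x
    using that assms unfolding histories_def follows_def y_def
    by (auto simp: PiE_iff extensional_def restrict_def fun_eq_iff)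
  then have "(\<Sum>x\<in>histories n. indicator (follows n x) \<omega> * F (x n)) =
      (\<Sum>x\<in>histories n. if x = y then F (x n) else 0)"
    by (intro sum.cong) (auto simp: indicator_def)
  also have "\<dots> = (if y \<in> histories n then F (y n) else 0)"
    using finite_histories by simp
  also have "y \<in> histories n \<longleftrightarrow> alive n \<omega>"
    by (auto simp: y_def histories_def alive_def PiE_iff)
  finally show ?thesis by (simp add: y_def)
qed

lemma expectation_killed:
  "expectation (killed f n) = (\<Sum>x\<in>histories n. prob (follows n x) * f (x n))"
proof -
  have "expectation (killed f n) =
      expectation (\<lambda>\<omega>. \<Sum>x\<in>histories n. indicator (follows n x) \<omega> * f (x n))"
    by (intro Bochner_Integration.integral_cong) (simp_all add: sum_histories killed_def)
  also have "\<dots> = (\<Sum>x\<in>histories n. expectation (\<lambda>\<omega>. indicator (follows n x) \<omega> * f (x n)))"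
    by (intro Bochner_Integration.integral_sum integrable_mult_left)
      (simp add: emeasure_eq_measure)
  finally show ?thesis by simp
qed

text \<open>Product form of \<open>jump\<close>. It also holds for null histories, where both sides
  vanish, so it can be summed over all of \<open>histories n\<close>.\<close>

lemma prob_follows_jump:
  assumes "x \<in> histories n"
  shows "prob (follows n x \<inter> {\<omega>\<in>space M. X (Suc n) \<omega> = u}) = prob (follows n x) * pmf (K (x n)) u"
proof (cases "prob (follows n x) = 0")
  case True
  have "prob (follows n x \<inter> {\<omega>\<in>space M. X (Suc n) \<omega> = u}) \<le> prob (follows n x)"
    by (intro finite_measure_mono) auto
  with True show ?thesis by (simp add: measure_le_0_iff)
next
  case False
  have "\<forall>i\<le>n. x i \<noteq> t"
    using assms by (auto simp: histories_def PiE_iff)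
  from jump[OF this, of u] False
  have "\<P>(\<omega> in M. X (Suc n) \<omega> = u \<bar> \<forall>i\<le>n. X i \<omega> = x i) = pmf (K (x n)) u"
    by (simp add: follows_def)
  moreover have "follows n x \<inter> {\<omega>\<in>space M. X (Suc n) \<omega> = u} =
      {\<omega>\<in>space M. X (Suc n) \<omega> = u \<and> (\<forall>i\<le>n. X i \<omega> = x i)}"
    by (auto simp: follows_def)
  ultimately show ?thesis
    using False by (simp add: cond_prob_def follows_def field_simps)
qed

lemma expectation_killed_Suc:
  assumes "f t = 0"
  shows "expectation (killed f (Suc n)) =
    expectation (killed (\<lambda>v. \<Sum>u\<in>UNIV. pmf (K v) u * f u) n)"
proof -
  let ?J = "\<lambda>u. {\<omega>\<in>space M. X (Suc n) \<omega> = u}"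
  have eq: "killed f (Suc n) \<omega> =
      (\<Sum>x\<in>histories n. \<Sum>u\<in>UNIV. indicator (follows n x \<inter> ?J u) \<omega> * f u)"
    if "\<omega> \<in> space M" for \<omega>
  proof -
    have J: "(\<Sum>u\<in>UNIV. indicator (?J u) \<omega> * f u) = f (X (Suc n) \<omega>)"
    proof -
      have "(\<Sum>u\<in>UNIV. indicator (?J u) \<omega> * f u) = (\<Sum>u\<in>UNIV. if u = X (Suc n) \<omega> then f u else 0)"
        using that by (intro sum.cong) (auto simp: indicator_def)
      then show ?thesis by simp
    qed
    \<comment> \<open>A walk absorbed exactly at time \<open>Suc n\<close> contributes
      \<open>f t = 0\<close>, so survival up to time \<open>n\<close> is the only condition
      left.\<close>
    have "killed f (Suc n) \<omega> = (if alive n \<omega> then f (X (Suc n) \<omega>) else 0)"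
      using assms by (auto simp: killed_def alive_def le_Suc_eq)
    also have "\<dots> = (\<Sum>x\<in>histories n. indicator (follows n x) \<omega> * f (X (Suc n) \<omega>))"
      using sum_histories[OF that, of n "\<lambda>_. f (X (Suc n) \<omega>)"] by simp
    finally show ?thesis
      by (simp only: J[symmetric] sum_distrib_left indicator_inter_arith mult.assoc)
  qed
  have "expectation (killed f (Suc n)) = expectation
      (\<lambda>\<omega>. \<Sum>x\<in>histories n. \<Sum>u\<in>UNIV. indicator (follows n x \<inter> ?J u) \<omega> * f u)"
    by (intro Bochner_Integration.integral_cong) (simp_all add: eq)
  also have "\<dots> = (\<Sum>x\<in>histories n. \<Sum>u\<in>UNIV. prob (follows n x \<inter> ?J u) * f u)"
  proof -
    have int: "integrable M (\<lambda>\<omega>. indicator (follows n x \<inter> ?J u) \<omega> * f u)" for x u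
      by (intro integrable_mult_left) (simp add: emeasure_eq_measure)
    have "expectation (\<lambda>\<omega>. indicator (follows n x \<inter> ?J u) \<omega> * f u) =
        prob (follows n x \<inter> ?J u) * f u" for x u
    proof -
      have "follows n x \<inter> ?J u \<inter> space M = follows n x \<inter> ?J u" by auto
      then show ?thesis by simp
    qed
    with int show ?thesis
      by (simp only: Bochner_Integration.integral_sum Bochner_Integration.integrable_sum)
  qed
  also have "\<dots> = (\<Sum>x\<in>histories n. prob (follows n x) * (\<Sum>u\<in>UNIV. pmf (K (x n)) u * f u))"
    by (intro sum.cong) (simp_all add: prob_follows_jump sum_distrib_left mult.assoc)
  finally show ?thesis by (simp add: expectation_killed)
qed

text \<open>The assumption \<open>f t = 0\<close> covers \<open>s = t\<close>, where the walk is
  dead from the start.\<close>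

lemma expectation_killed_0:
  assumes "f t = 0"
  shows "expectation (killed f 0) = f s"
proof -
  have "expectation (killed f 0) = expectation (\<lambda>_. f s)"
  proof (rule integral_cong_AE)
    show "AE \<omega> in M. killed f 0 \<omega> = f s"
      using X_0 by eventually_elim (auto simp: killed_def alive_def assms)
  qed simp_all
  then show ?thesis by (simp add: prob_space)
qed

lemma killed_mono:
  assumes "\<And>v. v \<noteq> t \<Longrightarrow> f v \<le> g v"
  shows "expectation (killed f n) \<le> expectation (killed g n)"
  by (intro integral_mono killed_integrable) (use assms in \<open>auto simp: killed_def alive_def\<close>)

lemma killed_diff:
  "expectation (killed (\<lambda>v. f v - g v) n) = expectation (killed f n) - expectation (killed g n)"
  by (subst Bochner_Integration.integral_diff[symmetric])
    (auto simp: killed_def[abs_def] intro!: Bochner_Integration.integral_cong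
      killed_integrable[unfolded killed_def[abs_def]])

lemma killed_const: "expectation (killed (\<lambda>_. c) n) = c * prob {\<omega>\<in>space M. alive n \<omega>}"
proof -
  have "expectation (killed (\<lambda>_. c) n) = expectation (\<lambda>\<omega>. c * indicator {\<omega>\<in>space M. alive n \<omega>} \<omega>)"
    by (intro Bochner_Integration.integral_cong) (auto simp: killed_def)
  moreover have "{\<omega>\<in>space M. alive n \<omega>} \<inter> space M = {\<omega>\<in>space M. alive n \<omega>}" by auto
  ultimately show ?thesis by simp
qed

section \<open>Summability of the survival probabilities\<close>

text \<open>Foster-Lyapunov argument: each step taken while alive raises the mean of a bounded
  function by at least \<open>\<delta>\<close>, so the expected number of such steps is
  finite.\<close>

lemma summable_alive:
  assumes "\<delta> > 0"
    and drift: "\<And>v. v \<noteq> t \<Longrightarrow> g v + \<delta> \<le> (\<Sum>u\<in>UNIV. pmf (K v) u * g u)"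
  shows "summable (\<lambda>n. prob {\<omega>\<in>space M. alive n \<omega>})"
proof -
  \<comment> \<open>The shift makes \<open>expectation_killed_Suc\<close> applicable and keeps the
    drift, because each \<open>K v\<close> has total mass 1.\<close>
  define h where "h v = g v - g t" for v
  have h_t: "h t = 0" by (simp add: h_def)
  define b where "b n = expectation (killed h n)" for n
  have pmf_sum: "(\<Sum>u\<in>UNIV. pmf (K v) u) = 1" for v
    by (rule sum_pmf_eq_1) auto
  have "\<delta> * prob {\<omega>\<in>space M. alive n \<omega>} \<le> b (Suc n) - b n" for n
  proof -
    have "\<delta> \<le> (\<Sum>u\<in>UNIV. pmf (K v) u * h u) - h v" if "v \<noteq> t" for v
      using drift[OF that]
      by (simp add: h_def right_diff_distrib sum_subtractf pmf_sum flip: sum_distrib_right)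
    then have "expectation (killed (\<lambda>_. \<delta>) n) \<le>
        expectation (killed (\<lambda>v. (\<Sum>u\<in>UNIV. pmf (K v) u * h u) - h v) n)"
      by (rule killed_mono)
    then show ?thesis
      by (simp add: killed_const killed_diff[of _ h] b_def expectation_killed_Suc[of h, OF h_t])
  qed
  then have step: "prob {\<omega>\<in>space M. alive n \<omega>} \<le> (b (Suc n) - b n) / \<delta>" for n
    using \<open>\<delta> > 0\<close> by (simp add: field_simps)
  have bound: "\<bar>b n\<bar> \<le> (\<Sum>v\<in>UNIV. \<bar>h v\<bar>)" for n
  proof -
    have "\<bar>b n\<bar> \<le> expectation (\<lambda>\<omega>. \<bar>killed h n \<omega>\<bar>)"
      unfolding b_def by (rule integral_abs_bound)
    also have "\<dots> \<le> expectation (\<lambda>\<omega>. \<Sum>v\<in>UNIV. \<bar>h v\<bar>)"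
      by (intro integral_mono killed_abs_le integrable_abs killed_integrable) simp
    finally show ?thesis by (simp add: prob_space)
  qed
  show ?thesis
  proof (rule bounded_imp_summable)
    fix n
    have "(\<Sum>k\<le>n. prob {\<omega>\<in>space M. alive k \<omega>}) \<le> (\<Sum>k\<le>n. (b (Suc k) - b k) / \<delta>)"
      by (intro sum_mono step)
    also have "\<dots> = (b (Suc n) - b 0) / \<delta>"
      by (simp add: sum_lessThan_telescope flip: sum_divide_distrib lessThan_Suc_atMost
          del: sum.lessThan_Suc)
    also have "\<dots> \<le> (2 * (\<Sum>v\<in>UNIV. \<bar>h v\<bar>)) / \<delta>"
      using bound[of "Suc n"] bound[of 0] \<open>\<delta> > 0\<close> by (intro divide_right_mono) auto
    finally show "(\<Sum>k\<le>n. prob {\<omega>\<in>space M. alive k \<omega>}) \<le> (2 * (\<Sum>v\<in>UNIV. \<bar>h v\<bar>)) / \<delta>" .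
  qed simp
qed

section \<open>Absorption and expected total gain\<close>

context
  assumes summable: "summable (\<lambda>n. prob {\<omega>\<in>space M. alive n \<omega>})"
begin

text \<open>The event of never meeting \<open>t\<close> lies in every \<open>alive n\<close>, and
  the probabilities of these tend to 0.\<close>

lemma AE_absorbed: "AE \<omega> in M. \<exists>n. X n \<omega> = t"
proof -
  have "prob {\<omega>\<in>space M. \<forall>n. X n \<omega> \<noteq> t} \<le> prob {\<omega>\<in>space M. alive n \<omega>}" for n
    by (intro finite_measure_mono) (auto simp: alive_def)
  then have "prob {\<omega>\<in>space M. \<forall>n. X n \<omega> \<noteq> t} \<le> 0"
    using summable_LIMSEQ_zero[OF summable] by (intro LIMSEQ_le_const) auto
  then have "prob {\<omega>\<in>space M. \<forall>n. X n \<omega> \<noteq> t} = 0"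
    by (simp add: measure_le_0_iff)
  then have "AE \<omega> in M. \<not> (\<forall>n. X n \<omega> \<noteq> t)"
    by (subst AE_iff_measurable[OF _ refl]) (auto simp: emeasure_eq_measure)
  then show ?thesis by simp
qed

lemma expectation_killed_tendsto_0: "(\<lambda>n. expectation (killed f n)) \<longlonglongrightarrow> 0"
proof (rule Lim_null_comparison)
  let ?C = "\<Sum>v\<in>UNIV. \<bar>f v\<bar>"
  show "\<forall>\<^sub>F n in sequentially. norm (expectation (killed f n)) \<le> ?C * prob {\<omega>\<in>space M. alive n \<omega>}"
  proof (intro always_eventually allI)
    fix n
    have "norm (expectation (killed f n)) \<le> expectation (\<lambda>\<omega>. \<bar>killed f n \<omega>\<bar>)"
      unfolding real_norm_def by (rule integral_abs_bound)
    also have "\<dots> \<le> expectation (killed (\<lambda>_. ?C) n)"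
      by (intro integral_mono integrable_abs killed_integrable)
        (auto simp: killed_def intro: member_le_sum)
    finally show "norm (expectation (killed f n)) \<le> ?C * prob {\<omega>\<in>space M. alive n \<omega>}"
      by (simp add: killed_const)
  qed
  show "(\<lambda>n. ?C * prob {\<omega>\<in>space M. alive n \<omega>}) \<longlonglongrightarrow> 0"
    using tendsto_mult_left[OF summable_LIMSEQ_zero[OF summable], of ?C] by simp
qed

text \<open>Almost surely \<open>S\<close> is the series of the \<open>killed f n\<close>. Their
  expected norms are at most a constant times the survival probabilities, hence summable, so
  expectation and series may be exchanged before telescoping.\<close>

lemma total_gain:
  assumes f: "\<And>v. v \<noteq> t \<Longrightarrow> f v = \<phi> v - (\<Sum>u\<in>UNIV. pmf (K v) u * \<phi> u)"
  defines "S \<equiv> (\<lambda>\<omega>. \<Sum>n | \<forall>m\<le>n. X m \<omega> \<noteq> t. f (X n \<omega>))"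
  shows "integrable M S" and "expectation S = \<phi> s - \<phi> t"
proof -
  \<comment> \<open>As with \<open>h\<close> above, subtracting a constant preserves the equation
    for \<open>f\<close> and gives the value 0 at \<open>t\<close>.\<close>
  define \<psi> where "\<psi> v = \<phi> v - \<phi> t" for v
  have \<psi>_t: "\<psi> t = 0" by (simp add: \<psi>_def)
  define a where "a n = expectation (killed \<psi> n)" for n
  let ?C = "\<Sum>v\<in>UNIV. \<bar>f v\<bar>"
  have pmf_sum: "(\<Sum>u\<in>UNIV. pmf (K v) u) = 1" for v
    by (rule sum_pmf_eq_1) auto
  have fin: "finite {n. \<forall>m\<le>n. X m \<omega> \<noteq> t}" if "\<exists>n. X n \<omega> = t" for \<omega>
  proof -
    from that obtain k where "X k \<omega> = t" by blast
    then have "{n. \<forall>m\<le>n. X m \<omega> \<noteq> t} \<subseteq> {..<k}"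
      by (auto simp: not_less[symmetric])
    then show ?thesis by (rule finite_subset) simp
  qed
  have sums: "(\<lambda>n. killed f n \<omega>) sums S \<omega>" if "\<exists>n. X n \<omega> = t" for \<omega>
  proof -
    have "(\<lambda>n. killed f n \<omega>) sums (\<Sum>n | \<forall>m\<le>n. X m \<omega> \<noteq> t. killed f n \<omega>)"
      using fin[OF that] by (intro sums_finite) (auto simp: killed_def alive_def)
    also have "(\<Sum>n | \<forall>m\<le>n. X m \<omega> \<noteq> t. killed f n \<omega>) = S \<omega>"
      unfolding S_def by (intro sum.cong) (auto simp: killed_def alive_def)
    finally show ?thesis .
  qed
  have abs_summable: "AE \<omega> in M. summable (\<lambda>n. norm (killed f n \<omega>))"
    using AE_absorbed
  proof eventually_elim
    case (elim \<omega>)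
    show ?case
      by (rule summable_finite[OF fin[OF elim]]) (auto simp: killed_def alive_def)
  qed
  have summable_norm: "summable (\<lambda>n. expectation (\<lambda>\<omega>. norm (killed f n \<omega>)))"
  proof (rule summable_comparison_test')
    show "summable (\<lambda>n. ?C * prob {\<omega>\<in>space M. alive n \<omega>})"
      by (intro summable_mult summable)
    fix n
    have "expectation (\<lambda>\<omega>. \<bar>killed f n \<omega>\<bar>) \<le> expectation (killed (\<lambda>_. ?C) n)"
      by (intro integral_mono integrable_abs killed_integrable)
        (auto simp: killed_def intro: member_le_sum)
    then show "norm (expectation (\<lambda>\<omega>. norm (killed f n \<omega>))) \<le> ?C * prob {\<omega>\<in>space M. alive n \<omega>}"
      by (simp add: killed_const)
  qed
  have S_eq: "AE \<omega> in M. (\<Sum>n. killed f n \<omega>) = S \<omega>"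
    using AE_absorbed by eventually_elim (rule sums_unique[OF sums, symmetric])
  have S_meas: "S \<in> borel_measurable M"
  proof -
    \<comment> \<open>Measurability needs an identity at every \<open>\<omega>\<close>. If
      \<open>t\<close> is never met, the index set of \<open>S\<close> is infinite and the sum is 0
      by default.\<close>
    have "S \<omega> = (if \<exists>n. X n \<omega> = t then \<Sum>n. killed f n \<omega> else 0)" for \<omega>
    proof (cases "\<exists>n. X n \<omega> = t")
      case True
      then show ?thesis by (simp add: sums_unique[OF sums, symmetric])
    next
      case False
      then show ?thesis by (simp add: S_def)
    qed
    then have "S = (\<lambda>\<omega>. if \<exists>n. X n \<omega> = t then \<Sum>n. killed f n \<omega> else 0)" by blast
    then show ?thesis by simp
  qed
  have "integrable M (\<lambda>\<omega>. \<Sum>n. killed f n \<omega>)"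
    by (rule integrable_suminf[OF killed_integrable abs_summable summable_norm])
  then show "integrable M S"
    by (rule integrable_cong_AE_imp[OF _ S_meas]) (use S_eq in auto)
  have gain: "expectation (killed f n) = a n - a (Suc n)" for n
  proof -
    have "f v = \<psi> v - (\<Sum>u\<in>UNIV. pmf (K v) u * \<psi> u)" if "v \<noteq> t" for v
      using f[OF that]
      by (simp add: \<psi>_def right_diff_distrib sum_subtractf pmf_sum flip: sum_distrib_right)
    then have "killed f n = killed (\<lambda>v. \<psi> v - (\<Sum>u\<in>UNIV. pmf (K v) u * \<psi> u)) n"
      by (auto simp: fun_eq_iff killed_def alive_def)
    then show ?thesis
      by (simp add: killed_diff[of \<psi>] a_def expectation_killed_Suc[of \<psi>, OF \<psi>_t])
  qed
  have "expectation S = expectation (\<lambda>\<omega>. \<Sum>n. killed f n \<omega>)"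
    using S_eq by (intro integral_cong_AE S_meas) auto
  also have "\<dots> = (\<Sum>n. expectation (killed f n))"
    by (rule integral_suminf[OF killed_integrable abs_summable summable_norm])
  \<comment> \<open>The subtracted \<open>0\<close> is the limit of \<open>a\<close>.\<close>
  also have "\<dots> = a 0 - 0"
    unfolding gain using expectation_killed_tendsto_0[of \<psi>]
    by (intro sums_unique[symmetric] telescope_sums') (simp add: a_def)
  also have "\<dots> = \<phi> s - \<phi> t"
    by (simp add: a_def expectation_killed_0 \<psi>_def)
  finally show "expectation S = \<phi> s - \<phi> t" .
qed

end

end

section \<open>The uniform neighbor walk on a connected graph\<close>

text \<open>A path from \<open>v\<close> to a different vertex \<open>t\<close> has a first edge.
  Nonemptiness gives \<open>pmf_of_set\<close> its intended meaning and makes the degree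
  positive.\<close>

lemma neighbors_nonempty:
  assumes "connected_graph E" "v \<noteq> t"
  shows "neighbors E v \<noteq> {}"
  using assms unfolding connected_graph_def neighbors_def
  by (metis (mono_tags) Collect_empty_eq converse_rtranclpE)

lemma pmf_neighbors:
  fixes E :: "'v::finite \<Rightarrow> 'v \<Rightarrow> bool"
  assumes "connected_graph E" "v \<noteq> t"
  shows "pmf (pmf_of_set (neighbors E v)) u = (if E v u then 1 else 0) / real (deg E v)"
  using neighbors_nonempty[OF assms] by (simp add: deg_def neighbors_def indicator_def)

text \<open>This is coordinate \<open>v\<close> of the eigenvalue equation, divided by the positive
  degree of \<open>v\<close>.\<close>

lemma laplacian_eigenvector_mean:
  fixes E :: "'v::finite \<Rightarrow> 'v \<Rightarrow> bool"
  assumes "connected_graph E" "eigenvector (laplacian E) \<phi> \<mu>" "v \<noteq> t"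
  shows "\<mu> * \<phi> $ v / real (deg E v) =
    \<phi> $ v - (\<Sum>u\<in>UNIV. pmf (pmf_of_set (neighbors E v)) u * \<phi> $ u)"
proof -
  have deg: "deg E v > 0"
    using neighbors_nonempty[OF assms(1,3)] by (simp add: deg_def card_gt_0_iff)
  let ?A = "\<Sum>u\<in>UNIV. (if E v u then 1 else 0) * \<phi> $ u"
  have "\<mu> * \<phi> $ v = (laplacian E *v \<phi>) $ v"
    using assms(2) by (simp add: eigenvector_def)
  also have "\<dots> = (\<Sum>u\<in>UNIV. (if v = u then real (deg E v) else 0) * \<phi> $ u) - ?A"
    by (simp add: laplacian_def degree_matrix_def adjacency_matrix_def matrix_vector_mult_def
        left_diff_distrib sum_subtractf)
  also have "(\<Sum>u\<in>UNIV. (if v = u then real (deg E v) else 0) * \<phi> $ u) = real (deg E v) * \<phi> $ v"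
    by (simp add: if_distrib[of "\<lambda>x. x * _"] cong: if_cong)
  finally have "\<mu> * \<phi> $ v / real (deg E v) = \<phi> $ v - ?A / real (deg E v)"
    using deg by (simp add: field_simps)
  then show ?thesis
    by (simp only: pmf_neighbors[OF assms(1,3)] sum_divide_distrib times_divide_eq_left)
qed

text \<open>Some neighbor \<open>w\<close> of \<open>v\<close> is closer to \<open>t\<close>. It is
  chosen with probability at least \<open>1 / CARD('v)\<close>, and its term alone already gives
  twice \<open>g v\<close>.\<close>

lemma connected_graph_drift:
  fixes E :: "'v::finite \<Rightarrow> 'v \<Rightarrow> bool"
  assumes "connected_graph E"
  obtains g :: "'v \<Rightarrow> real" and \<delta> where "\<delta> > 0"
    "\<And>v. v \<noteq> t \<Longrightarrow> g v + \<delta> \<le> (\<Sum>u\<in>UNIV. pmf (pmf_of_set (neighbors E v)) u * g u)"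
proof
  define d where "d v = (LEAST n. (E ^^ n) v t)" for v
  \<comment> \<open>The factor \<open>CARD('v)\<close> offsets the smallest possible jump
    probability; the factor 2 leaves a surplus of \<open>g v\<close>.\<close>
  define \<epsilon> where "\<epsilon> = 1 / (2 * real CARD('v))"
  define g where "g v = \<epsilon> ^ d v" for v
  have \<epsilon>: "0 < \<epsilon>" "\<epsilon> \<le> 1"
    using zero_less_card_finite[where 'a = 'v] by (simp_all add: \<epsilon>_def del: zero_less_card_finite)
  then have g_pos: "0 < g v" for v by (simp add: g_def)
  \<comment> \<open>Since \<open>g\<close> is positive on a finite type, its minimum turns the
    doubling into a uniform additive drift.\<close>
  show "Min (range g) > 0" by (simp add: g_pos)
  fix v assume "v \<noteq> t"
  have "\<exists>n. (E ^^ n) v t"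
    using assms by (auto simp: connected_graph_def dest: rtranclp_imp_relpowp)
  then have dv: "(E ^^ d v) v t"
    unfolding d_def by (rule LeastI_ex)
  with \<open>v \<noteq> t\<close> obtain m where m: "d v = Suc m"
    by (cases "d v") auto
  from dv m obtain w where w: "E v w" "(E ^^ m) w t"
    by (metis relpowp_Suc_D2)
  \<comment> \<open>An inequality is enough, as powers of \<open>\<epsilon>\<close> decrease with
    the exponent.\<close>
  have "d w \<le> m"
    unfolding d_def using w(2) by (rule Least_le)
  then have "\<epsilon> ^ m \<le> g w"
    using \<epsilon> unfolding g_def by (intro power_decreasing) auto
  moreover have "g v = \<epsilon> * \<epsilon> ^ m" by (simp add: g_def m)
  ultimately have gvw: "g v \<le> \<epsilon> * g w" using \<epsilon> by simp
  have deg: "0 < deg E v" "deg E v \<le> CARD('v)"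
    using neighbors_nonempty[OF assms \<open>v \<noteq> t\<close>] by (simp_all add: deg_def card_gt_0_iff card_mono)
  have "g v + Min (range g) \<le> 2 * g v"
    by simp
  also have "\<dots> \<le> 1 / real CARD('v) * g w"
    using gvw by (simp add: \<epsilon>_def)
  also have "\<dots> \<le> 1 / real (deg E v) * g w"
    using deg g_pos[of w] by (intro mult_right_mono divide_left_mono) auto
  also have "\<dots> = pmf (pmf_of_set (neighbors E v)) w * g w"
    using w(1) by (simp add: pmf_neighbors[OF assms \<open>v \<noteq> t\<close>])
  also have "\<dots> \<le> (\<Sum>u\<in>UNIV. pmf (pmf_of_set (neighbors E v)) u * g u)"
    by (rule member_le_sum) (simp_all add: g_pos less_imp_le)
  finally show "g v + Min (range g) \<le> (\<Sum>u\<in>UNIV. pmf (pmf_of_set (neighbors E v)) u * g u)" .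
qed

text \<open>The first two conjuncts keep default values out of the expectation: the convention for
  an infinite game acts only on a null set, and the Bochner integral is a genuine one.\<close>

theorem theorem1:
  fixes E :: "'v::finite \<Rightarrow> 'v \<Rightarrow> bool"
    and \<phi> :: "real^'v" and \<mu> :: real and s t :: 'v
    and M :: "'a measure" and X :: "nat \<Rightarrow> 'a \<Rightarrow> 'v"
  assumes "simple_graph E" and "connected_graph E"
    and "eigenvector (laplacian E) \<phi> \<mu>"
    and "random_game E s t M X"
  shows "(AE \<omega> in M. \<exists>n. X n \<omega> = t) \<and>
    integrable M (\<lambda>\<omega>. payoff E \<mu> \<phi> t (\<lambda>n. X n \<omega>)) \<and>
    (\<integral>\<omega>. payoff E \<mu> \<phi> t (\<lambda>n. X n \<omega>) \<partial>M) = \<phi> $ s - \<phi> $ t"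
proof -
  interpret prob_space M
    using assms(4) by (simp add: random_game_def)
  interpret absorbed_walk M "\<lambda>v. pmf_of_set (neighbors E v)" s t X
    by unfold_locales (use assms(4) in \<open>auto simp: random_game_def\<close>)
  have summable: "summable (\<lambda>n. prob {\<omega>\<in>space M. alive n \<omega>})"
    using connected_graph_drift[OF assms(2), of t] summable_alive by metis
  have "\<mu> * \<phi> $ v / real (deg E v) =
      \<phi> $ v - (\<Sum>u\<in>UNIV. pmf (pmf_of_set (neighbors E v)) u * \<phi> $ u)" if "v \<noteq> t" for v
    using laplacian_eigenvector_mean[OF assms(2,3) that] .
  from total_gain[OF summable this] AE_absorbed[OF summable] show ?thesis
    by (simp add: payoff_def)
qed

end
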